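(* Let $G$ be a graph. Then $\mathcal Q$ is a parallel increasing path cover of $G$ if and only if $\mathcal Q$ is the chain set of some relaxed chronology $\mathcal F$ of standard forces for some standard zero forcing set $B$ of $G$. Under this correspondence, a collection of block partitions $\{(A_{i,j})_{j=0}^{n_i-1}\}_{i=1}^m$ of $\{0,1,\dots,K\}$ that is a witness that $\mathcal Q$ (with vertices labeled $v_{i,j}$, $1\le i\le m$, $0\le j\le n_i-1$) is a parallel increasing path cover corresponds to a relaxed chronology $\mathcal F=\{F^{(k)}\}_{k=1}^K$ for the standard zero forcing set $\{v_{i,0}\}_{i=1}^m$, with chain set $\mathcal Q$, such that $A_{i,j}=\operatorname{act}_{\mathcal F}(v_{i,j})$ for all $i,j$. That is: for every such witness there is such an $\mathcal F$; and for every relaxed chronology $\mathcal F$ of a standard zero forcing set, with chain set having vertices $v_{i,j}$ labeled in forcing order along the chains, the sets $\operatorname{act}_{\mathcal F}(v_{i,j})$ form a witness that the chain set is a parallel increasing path cover.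
   Context: All graphs are finite, simple and undirected; $\mathbb N$ contains $0$. Standard zero forcing: each vertex is blue or white. A blue vertex $u$ with exactly one white neighbor $v$ can force $v$ to become blue (written $u\to v$). A set $B$ is a standard zero forcing set if, starting with exactly $B$ blue, repeated forcing turns all vertices blue. $S(G,B)$ denotes the set of forces $v\to u$ that are valid when exactly the vertices of $B$ are blue. Relaxed chronology: let $B$ be a standard zero forcing set of $G$ and $\mathcal F=\{F^{(k)}\}_{k=1}^K$ an ordered family of sets of forces ($F^{(k)}=\emptyset$ allowed). Put $E^{[0]}=E^{(0)}=B$, $E^{(k)}=\{u: v\to u\in F^{(k)}\text{ for some }v\}$, $E^{[k]}=\bigcup_{j=0}^kE^{(j)}$. $\mathcal F$ is a relaxed chronology for $B$ if (1) $F^{(k)}\subseteq S(G,E^{[k-1]})$ for all $k$; (2) $v_1\to u,v_2\to u\in F^{(k)}$ implies $v_1=v_2$; (3) $E^{[K]}=V(G)$. The active times $\operatorname{act}_{\mathcal F}(v)$ are those $k\in\{0,\dots,K\}$ such that $v\in E^{[k]}$ and $v$ performs no force in $F^{(1)},\dots,F^{(k)}$. The chain set of $\mathcal F$ is the collection of forcing chains $(v_0,v_1,\dots,v_\ell)$, one for each $v_0\in B$, where $v_{i-1}\to v_i\in\bigcup_kF^{(k)}$ and $v_\ell$ performs no force; each chain is identified with the induced path on its vertices. A path cover of $G$ is a collection of induced paths of $G$ such that each vertex is in exactly one path. A block partition of $\{0,\dots,K\}$ is a partition $(A_0,\dots,A_{n-1})$ of it into nonempty parts such that $j_1<j_2$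 implies every element of $A_{j_1}$ is less than every element of $A_{j_2}$. Parallel increasing path cover (PIP): a path cover $\mathcal Q=\{Q_i\}_{i=1}^m$ of $G$, with $n_i=|V(Q_i)|$ and the vertices of $Q_i$ labeled $v_{i,0},\dots,v_{i,n_i-1}$ in path order (so $v_{i,j_1}v_{i,j_2}\in E(G)$ iff $|j_1-j_2|=1$), for which there exist $K\in\mathbb N$ and, for each $i$, a block partition $(A_{i,j})_{j=0}^{n_i-1}$ of $\{0,\dots,K\}$ such that for $i_1\neq i_2$, $v_{i_1,j_1}v_{i_2,j_2}\in E(G)$ implies $A_{i_1,j_1}\cap A_{i_2,j_2}\ne\emptyset$. Such a collection of block partitions is called a witness that $\mathcal Q$ is a PIP. *)

theory Defs
  imports Main "Graph_Theory.Digraph_Component"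
begin

text \<open>
  Finite simple undirected graphs are rendered by the locale predicate \<^term>\<open>graph G\<close>: finite,
  loop-free symmetric digraphs without parallel arcs. The edge \<open>uv\<close> is present iff
  \<open>u \<rightarrow>\<^bsub>G\<^esub> v\<close>. A force from \<open>v\<close> to \<open>u\<close> is the pair \<open>(v, u)\<close>.
\<close>

section \<open>Standard zero forcing\<close>

definition forces :: "('a, 'b) pre_digraph \<Rightarrow> 'a set \<Rightarrow> ('a \<times> 'a) set" where
  "forces G B = {(v, u). v \<in> B \<and> {w \<in> verts G - B. v \<rightarrow>\<^bsub>G\<^esub> w} = {u}}"

definition force_step :: "('a, 'b) pre_digraph \<Rightarrow> 'a set \<Rightarrow> 'a set \<Rightarrow> bool" where
  "force_step G C C' \<longleftrightarrow> (\<exists>v u. (v, u) \<in> forces G C \<and> C' = insert u C)"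

definition zero_forcing_set :: "('a, 'b) pre_digraph \<Rightarrow> 'a set \<Rightarrow> bool" where
  "zero_forcing_set G B \<longleftrightarrow> B \<subseteq> verts G \<and> (force_step G)\<^sup>*\<^sup>* B (verts G)"

section \<open>Relaxed chronologies\<close>

text \<open>
  A family \<open>F\<^sup>(\<^sup>1\<^sup>), \<dots>, F\<^sup>(\<^sup>K\<^sup>)\<close> is a function \<open>F\<close> on \<^typ>\<open>nat\<close> together with \<open>K\<close>; values of \<open>F\<close> outside
  \<open>{1..K}\<close> play no role. \<open>newly_blue\<close> is \<open>E\<^sup>(\<^sup>k\<^sup>)\<close> and \<open>blue\<close> is \<open>E\<^sup>[\<^sup>k\<^sup>]\<close>.
\<close>

definition newly_blue :: "'a set \<Rightarrow> (nat \<Rightarrow> ('a \<times> 'a) set) \<Rightarrow> nat \<Rightarrow> 'a set" where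
  "newly_blue B F k = (if k = 0 then B else {u. \<exists>v. (v, u) \<in> F k})"

definition blue :: "'a set \<Rightarrow> (nat \<Rightarrow> ('a \<times> 'a) set) \<Rightarrow> nat \<Rightarrow> 'a set" where
  "blue B F k = (\<Union>j\<in>{0..k}. newly_blue B F j)"

definition relaxed_chronology ::
  "('a, 'b) pre_digraph \<Rightarrow> 'a set \<Rightarrow> nat \<Rightarrow> (nat \<Rightarrow> ('a \<times> 'a) set) \<Rightarrow> bool" where
  "relaxed_chronology G B K F \<longleftrightarrow>
     (\<forall>k\<in>{1..K}. F k \<subseteq> forces G (blue B F (k - 1))) \<and>
     (\<forall>k\<in>{1..K}. \<forall>v1 v2 u. (v1, u) \<in> F k \<and> (v2, u) \<in> F k \<longrightarrow> v1 = v2) \<and>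
     blue B F K = verts G"

definition act :: "'a set \<Rightarrow> nat \<Rightarrow> (nat \<Rightarrow> ('a \<times> 'a) set) \<Rightarrow> 'a \<Rightarrow> nat set" where
  "act B K F v = {k \<in> {0..K}. v \<in> blue B F k \<and> \<not> (\<exists>j\<in>{1..k}. \<exists>u. (v, u) \<in> F j)}"

definition all_forces :: "nat \<Rightarrow> (nat \<Rightarrow> ('a \<times> 'a) set) \<Rightarrow> ('a \<times> 'a) set" where
  "all_forces K F = (\<Union>k\<in>{1..K}. F k)"

definition forcing_chain :: "'a set \<Rightarrow> nat \<Rightarrow> (nat \<Rightarrow> ('a \<times> 'a) set) \<Rightarrow> 'a list \<Rightarrow> bool" where
  "forcing_chain B K F c \<longleftrightarrow>
     c \<noteq> [] \<and> hd c \<in> B \<and> successively (\<lambda>v u. (v, u) \<in> all_forces K F) c \<and>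
     (\<forall>u. (last c, u) \<notin> all_forces K F)"

text \<open>Each chain is identified with the subgraph of \<open>G\<close> induced by its vertices.\<close>

definition chain_set ::
  "('a, 'b) pre_digraph \<Rightarrow> 'a set \<Rightarrow> nat \<Rightarrow> (nat \<Rightarrow> ('a \<times> 'a) set) \<Rightarrow> ('a, 'b) pre_digraph set" where
  "chain_set G B K F = {G \<restriction> set c | c. forcing_chain B K F c}"

section \<open>Parallel increasing path covers\<close>

text \<open>\<open>path_order P xs\<close>: \<open>P\<close> is a path and \<open>xs\<close> lists its vertices in one of its path orders.\<close>

definition path_order :: "('a, 'b) pre_digraph \<Rightarrow> 'a list \<Rightarrow> bool" where
  "path_order P xs \<longleftrightarrow>
     xs \<noteq> [] \<and> distinct xs \<and> verts P = set xs \<and>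
     (\<forall>a<length xs. \<forall>b<length xs. xs ! a \<rightarrow>\<^bsub>P\<^esub> xs ! b \<longleftrightarrow> \<bar>int a - int b\<bar> = 1)"

definition induced_path :: "('a, 'b) pre_digraph \<Rightarrow> ('a, 'b) pre_digraph \<Rightarrow> bool" where
  "induced_path G P \<longleftrightarrow> induced_subgraph P G \<and> (\<exists>xs. path_order P xs)"

definition path_cover :: "('a, 'b) pre_digraph \<Rightarrow> ('a, 'b) pre_digraph set \<Rightarrow> bool" where
  "path_cover G Q \<longleftrightarrow>
     (\<forall>P\<in>Q. induced_path G P) \<and> (\<forall>v\<in>verts G. \<exists>!P. P \<in> Q \<and> v \<in> verts P)"

text \<open>
  \<open>path_labelling Q m v\<close>: for some enumeration \<open>Q\<^sub>1, \<dots>, Q\<^sub>m\<close> of \<open>Q\<close> without repetition, the list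
  \<open>v i\<close> contains the vertices of \<open>Q\<^sub>i\<close> in path order. Thus \<open>v\<^sub>i\<^sub>,\<^sub>j\<close> is \<open>v i ! j\<close> and \<open>n\<^sub>i\<close> is
  \<open>length (v i)\<close>.
\<close>

definition path_labelling :: "('a, 'b) pre_digraph set \<Rightarrow> nat \<Rightarrow> (nat \<Rightarrow> 'a list) \<Rightarrow> bool" where
  "path_labelling Q m v \<longleftrightarrow>
     (\<exists>P. bij_betw P {1..m} Q \<and> (\<forall>i\<in>{1..m}. path_order (P i) (v i)))"

definition block_partition :: "nat \<Rightarrow> nat \<Rightarrow> (nat \<Rightarrow> nat set) \<Rightarrow> bool" where
  "block_partition K n A \<longleftrightarrow>
     (\<Union>j<n. A j) = {0..K} \<and> (\<forall>j<n. A j \<noteq> {}) \<and> disjoint_family_on A {..<n} \<and>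
     (\<forall>j1<n. \<forall>j2<n. j1 < j2 \<longrightarrow> (\<forall>a\<in>A j1. \<forall>b\<in>A j2. a < b))"

definition pip_witness ::
  "('a, 'b) pre_digraph \<Rightarrow> nat \<Rightarrow> (nat \<Rightarrow> 'a list) \<Rightarrow> nat \<Rightarrow> (nat \<Rightarrow> nat \<Rightarrow> nat set) \<Rightarrow> bool" where
  "pip_witness G m v K A \<longleftrightarrow>
     (\<forall>i\<in>{1..m}. block_partition K (length (v i)) (A i)) \<and>
     (\<forall>i1\<in>{1..m}. \<forall>i2\<in>{1..m}. i1 \<noteq> i2 \<longrightarrow>
        (\<forall>j1<length (v i1). \<forall>j2<length (v i2).
           v i1 ! j1 \<rightarrow>\<^bsub>G\<^esub> v i2 ! j2 \<longrightarrow> A i1 j1 \<inter> A i2 j2 \<noteq> {}))"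

text \<open>
  A path has no preferred direction, so the labelling (a choice of direction for every path) is
  existentially quantified.
\<close>

definition parallel_increasing_path_cover ::
  "('a, 'b) pre_digraph \<Rightarrow> ('a, 'b) pre_digraph set \<Rightarrow> bool" where
  "parallel_increasing_path_cover G Q \<longleftrightarrow>
     path_cover G Q \<and> (\<exists>m v. path_labelling Q m v \<and> (\<exists>K A. pip_witness G m v K A))"

end

theory Submission
  imports Defs
begin

text \<open>
  A block partition of \<open>{0..K}\<close> is an increasing sequence of start times, the start time of the
  block of a vertex being the time at which the vertex turns blue; within a chain, the block of a
  vertex ends when that vertex forces its successor. If a force \<open>x \<rightarrow> y\<close> happens at time \<open>k\<close>, then all
  neighbours of \<open>x\<close> except \<open>y\<close> turn blue before time \<open>k\<close>. Hence an edge joining different chains has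
  intersecting active intervals at its ends, and no chain has a chord; conversely, intersecting
  blocks are exactly what is needed for all forces prescribed by the start times to be valid.
\<close>

section \<open>Block partitions as sequences of start times\<close>

text \<open>Half-open intervals between consecutive start times leave no gap and do not overlap. The
  sentinel \<open>s n = Suc K\<close> closes the last block, so that it needs no separate
  treatment.\<close>

lemma block_partitionI:
  fixes s :: "nat \<Rightarrow> nat"
  assumes "s 0 = 0" "s n = Suc K" "\<And>j. j < n \<Longrightarrow> s j < s (Suc j)"
    "\<And>j. j < n \<Longrightarrow> A j = {s j..<s (Suc j)}"
  shows "block_partition K n A"
proof -
  have mono: "s j \<le> s i" if "j \<le> i" "i \<le> n" for i j
    using that
  proof (induction i rule: dec_induct)
    case (step i)
    then show ?case using assms(3)[of i] by simp
  qed simp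
  have less: "a < b" if "j1 < n" "j2 < n" "j1 < j2" "a \<in> A j1" "b \<in> A j2" for j1 j2 a b
  proof -
    have "a < s (Suc j1)" "s j2 \<le> b" using that assms(4) by auto
    moreover have "s (Suc j1) \<le> s j2" using that by (intro mono) auto
    ultimately show ?thesis by simp
  qed
  \<comment> \<open>Covering by induction on the number of blocks: the first \<open>i\<close> of
    them fill everything below \<open>s i\<close>.\<close>
  have cover: "(\<Union>j<i. A j) = {..<s i}" if "i \<le> n" for i
    using that
  proof (induction i)
    case (Suc i)
    then show ?case using assms(3)[of i] assms(4)[of i] by (auto simp: lessThan_Suc)
  qed (simp add: assms(1))
  show ?thesis
    unfolding block_partition_def
  proof (intro conjI allI impI ballI)
    show "(\<Union>j<n. A j) = {0..K}" using cover[of n] assms(2) by auto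
    show "A j \<noteq> {}" if "j < n" for j using assms(3,4)[OF that] by simp
    show "disjoint_family_on A {..<n}"
      unfolding disjoint_family_on_def
    proof (intro ballI impI)
      fix j1 j2 assume j: "j1 \<in> {..<n}" "j2 \<in> {..<n}" "j1 \<noteq> j2"
      then have "j1 < j2 \<or> j2 < j1" by linarith
      then have "\<not> (x \<in> A j1 \<and> x \<in> A j2)" for x
        using less[of j1 j2 x x] less[of j2 j1 x x] j by auto
      then show "A j1 \<inter> A j2 = {}" by blast
    qed
  qed (rule less)
qed

lemma block_partitionE:
  assumes "block_partition K n A"
  obtains s :: "nat \<Rightarrow> nat" where "s 0 = 0" "s n = Suc K" "\<And>j. j < n \<Longrightarrow> s j < s (Suc j)"
    "\<And>j. j < n \<Longrightarrow> A j = {s j..<s (Suc j)}"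
proof -
  \<comment> \<open>Start times are the block minima. The default \<open>Suc K\<close> at index
    \<open>n\<close> plays the part of the start of a block after the last one.\<close>
  define s where "s j = (if j < n then Min (A j) else Suc K)" for j
  have cover: "(\<Union>j<n. A j) = {0..K}" and ne: "\<And>j. j < n \<Longrightarrow> A j \<noteq> {}"
    and ordered: "\<forall>j1<n. \<forall>j2<n. j1 < j2 \<longrightarrow> (\<forall>a\<in>A j1. \<forall>b\<in>A j2. a < b)"
    using assms unfolding block_partition_def by (elim conjE; assumption | blast)+
  have less: "a < b" if "j1 < n" "j2 < n" "j1 < j2" "a \<in> A j1" "b \<in> A j2" for j1 j2 a b
    using ordered[rule_format, OF that] .
  have index: "\<exists>i<n. x \<in> A i" if "x \<le> K" for x
  proof -
    have "x \<in> (\<Union>j<n. A j)" unfolding cover using that by simp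
    then show ?thesis by blast
  qed
  have sub: "A j \<subseteq> {0..K}" if "j < n" for j using cover that by blast
  have fin: "finite (A j)" if "j < n" for j using sub[OF that] finite_subset by blast
  have s_in: "s j \<in> A j" if "j < n" for j using fin ne that by (simp add: s_def)
  have s_le: "s j \<le> a" if "j < n" "a \<in> A j" for a j using fin that by (simp add: s_def)
  have s_gr: "a < s (Suc j)" if "j < n" "a \<in> A j" for a j
  proof (cases "Suc j < n")
    case True
    then show ?thesis using less[of j "Suc j" a "s (Suc j)"] s_in that by simp
  next
    case False
    then show ?thesis using sub[OF that(1)] that(2) by (auto simp: s_def)
  qed
  have n0: "n > 0"
  proof (rule ccontr)
    assume "\<not> n > 0"
    then have "{0..K} = {}" using cover by simp
    then show False by simp
  qed
  have 1: "s 0 = 0"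
  proof -
    obtain i where i: "i < n" "0 \<in> A i" using index[of 0] by auto
    \<comment> \<open>If 0 lay in a later block, the minimum of the first block would be less than
      0.\<close>
    then have "i = 0" using less[of 0 i "s 0" 0] s_in[OF n0] n0 by (cases "i = 0") auto
    then show ?thesis using s_le[OF n0, of 0] i by simp
  qed
  have 2: "s n = Suc K" by (simp add: s_def)
  have 3: "s j < s (Suc j)" if "j < n" for j using s_gr[OF that s_in[OF that]] .
  have 4: "A j = {s j..<s (Suc j)}" if j: "j < n" for j
  proof
    show "A j \<subseteq> {s j..<s (Suc j)}" using s_le s_gr j by auto
    show "{s j..<s (Suc j)} \<subseteq> A j"
    proof
      fix x assume x: "x \<in> {s j..<s (Suc j)}"
      have "x \<le> K"
      proof (cases "Suc j < n")
        case True
        then show ?thesis using x sub[OF True] s_in[OF True] by auto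
      qed (use x in \<open>simp add: s_def\<close>)
      then obtain i where i: "i < n" "x \<in> A i" using index by blast
      \<comment> \<open>Only \<open>i = j\<close> is consistent with the bounds on \<open>x\<close>.
        The case \<open>i = Suc j\<close> is separate because the minimum of a block is merely at
        most, not below, the elements of its own block.\<close>
      consider "i < j" | "i = j" | "i = Suc j" | "Suc j < i" by linarith
      then show "x \<in> A j"
      proof cases
        case 1
        then show ?thesis using less[OF i(1) j 1 i(2) s_in[OF j]] x by simp
      next
        case 2
        then show ?thesis using i by simp
      next
        case 3
        then show ?thesis using s_le[OF i] x by simp
      next
        case 4
        then have "Suc j < n" using i by simp
        then show ?thesis using less[OF _ i(1) 4 s_in i(2)] x by fastforce
      qed
    qed
  qed
  show thesis using 1 2 3 4 by (rule that)
qed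

section \<open>Chains of a relaxed chronology\<close>

lemma adj_induce_subgraph:
  "u \<rightarrow>\<^bsub>G \<restriction> S\<^esub> w \<longleftrightarrow> u \<in> S \<and> w \<in> S \<and> u \<rightarrow>\<^bsub>G\<^esub> w"
  by (auto simp: arcs_ends_conv)

text \<open>Right-uniqueness determines every successor from the common head, and neither list can
  stop before the other because a last entry has no successor. This will identify a forcing chain by
  its starting vertex.\<close>

lemma successively_terminal_unique:
  assumes "\<And>x y z. R x y \<Longrightarrow> R x z \<Longrightarrow> y = z"
    and "successively R xs" "xs \<noteq> []" "\<And>y. \<not> R (last xs) y"
    and "successively R ys" "ys \<noteq> []" "\<And>y. \<not> R (last ys) y"
    and "hd xs = hd ys"
  shows "xs = ys"
  using assms(2-)
proof (induction xs arbitrary: ys)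
  case (Cons x xs)
  obtain y ys' where ys: "ys = y # ys'" using Cons.prems(5) by (cases ys) auto
  show ?case
  proof (cases "xs = [] \<or> ys' = []")
    case True
    then show ?thesis using Cons.prems ys by (auto simp: successively_Cons split: if_splits)
  next
    case False
    then have "hd xs = hd ys'" using Cons.prems ys assms(1) by (auto simp: successively_Cons)
    then have "xs = ys'" using Cons.IH[of ys'] Cons.prems ys False by (auto simp: successively_Cons)
    then show ?thesis using Cons.prems ys by simp
  qed
qed simp

lemma forces_iff:
  "(v, u) \<in> forces G C \<longleftrightarrow>
     v \<in> C \<and> u \<in> verts G \<and> u \<notin> C \<and> v \<rightarrow>\<^bsub>G\<^esub> u \<and>
     (\<forall>w\<in>verts G. v \<rightarrow>\<^bsub>G\<^esub> w \<longrightarrow> w = u \<or> w \<in> C)"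
  by (auto simp: forces_def set_eq_iff)

text \<open>More blue vertices leave fewer white neighbours, so the only white neighbour
  \<open>u\<close> stays the only one as long as it is white.\<close>

lemma forces_mono:
  assumes "(v, u) \<in> forces G C" "C \<subseteq> D" "u \<notin> D"
  shows "(v, u) \<in> forces G D"
  using assms unfolding forces_iff by blast

lemma blue_0: "blue B F 0 = B"
  by (simp add: blue_def newly_blue_def)

lemma blue_Suc: "blue B F (Suc k) = blue B F k \<union> {u. \<exists>v. (v, u) \<in> F (Suc k)}"
  by (simp add: blue_def newly_blue_def atLeast0_atMost_Suc Un_commute)

lemma blue_mono: "j \<le> k \<Longrightarrow> blue B F j \<subseteq> blue B F k"
  unfolding blue_def by (rule UN_mono) auto

section \<open>Birth times and forces\<close>

locale chronology = graph G for G :: "('a, 'b) pre_digraph" +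
  fixes B :: "'a set" and K :: nat and F :: "nat \<Rightarrow> ('a \<times> 'a) set"
  assumes chron: "relaxed_chronology G B K F"
begin

abbreviation blue_at :: "nat \<Rightarrow> 'a set" where "blue_at \<equiv> blue B F"
abbreviation forced :: "'a \<Rightarrow> 'a \<Rightarrow> bool" where "forced v u \<equiv> (v, u) \<in> all_forces K F"

text \<open>Turns membership in the growing sets \<open>blue_at k\<close> into comparison of
  numbers, for vertices of \<open>G\<close>; see \<open>birth_le_iff\<close>.\<close>

definition birth :: "'a \<Rightarrow> nat" where
  "birth v = (LEAST k. v \<in> blue_at k)"

lemma blue_K: "blue_at K = verts G"
  using chron unfolding relaxed_chronology_def by blast

lemma F_subset_forces: "k \<in> {1..K} \<Longrightarrow> F k \<subseteq> forces G (blue_at (k - 1))"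
  using chron unfolding relaxed_chronology_def by blast

lemma birth_le_iff:
  assumes "v \<in> verts G"
  shows "birth v \<le> k \<longleftrightarrow> v \<in> blue_at k"
proof
  have "v \<in> blue_at (birth v)"
    unfolding birth_def by (rule LeastI[where P = "\<lambda>k. v \<in> blue_at k" and k = K]) (simp add: blue_K assms)
  then show "birth v \<le> k \<Longrightarrow> v \<in> blue_at k" using blue_mono subsetD by metis
  show "v \<in> blue_at k \<Longrightarrow> birth v \<le> k" unfolding birth_def by (rule Least_le)
qed

lemma birth_le_K: "v \<in> verts G \<Longrightarrow> birth v \<le> K"
  by (simp add: birth_le_iff blue_K)

text \<open>A force at time \<open>k\<close> is valid for \<open>blue_at (k - 1)\<close>: the tail
  and all its neighbours except the head are already blue, the head is still white. Since
  \<open>k\<close> is positive, being born before \<open>k\<close> means being in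
  \<open>blue_at (k - 1)\<close>.\<close>

lemma force_birth:
  assumes "k \<in> {1..K}" "(v, u) \<in> F k"
  shows "v \<in> verts G" "u \<in> verts G" "v \<rightarrow>\<^bsub>G\<^esub> u" "birth v < k" "birth u = k"
    "\<And>w. v \<rightarrow>\<^bsub>G\<^esub> w \<Longrightarrow> w = u \<or> birth w < k"
proof -
  have f: "(v, u) \<in> forces G (blue_at (k - 1))" using F_subset_forces assms by blast
  have "blue_at (k - 1) \<subseteq> verts G"
    unfolding blue_K[symmetric] by (rule blue_mono) (use assms(1) in auto)
  then show v: "v \<in> verts G" and u: "u \<in> verts G" and "v \<rightarrow>\<^bsub>G\<^esub> u" using f by (auto simp: forces_iff)
  have lt: "x < k \<longleftrightarrow> x \<le> k - 1" for x using assms(1) by auto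
  show "birth v < k" using f v by (simp add: lt birth_le_iff forces_iff)
  have "\<not> birth u < k" using f u by (simp add: lt birth_le_iff forces_iff)
  moreover have "u \<in> blue_at k"
    using assms blue_Suc[of B F "k - 1"] by auto
  ultimately show "birth u = k" using birth_le_iff[OF u, of k] by simp
  show "w = u \<or> birth w < k" if "v \<rightarrow>\<^bsub>G\<^esub> w" for w
    using f that adj_in_verts[OF that] by (auto simp: lt birth_le_iff forces_iff)
qed

text \<open>A vertex can be the head of a force only at its own birth, so the time of a force can be
  read off from its head.\<close>

lemma forced_iff: "forced v u \<longleftrightarrow> birth u \<in> {1..K} \<and> (v, u) \<in> F (birth u)"
  unfolding all_forces_def using force_birth(5) by fastforce

lemma forcedD:
  assumes "forced v u"
  shows "v \<in> verts G" "u \<in> verts G" "v \<rightarrow>\<^bsub>G\<^esub> u" "birth v < birth u" "0 < birth u"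
  using force_birth[of "birth u" v u] assms by (auto simp: forced_iff)

text \<open>At the earlier of two forces by \<open>v\<close>, every other neighbour of
  \<open>v\<close> was born strictly before. The head of the second force was not, so it is the same
  vertex.\<close>

lemma forced_right_unique:
  assumes "forced v u" "forced v u'"
  shows "u = u'"
proof -
  have *: "x = y" if "forced v x" "forced v y" "birth x \<le> birth y" for x y
    using force_birth(6)[of "birth x" v x y] that forcedD(3)[OF that(2)] by (auto simp: forced_iff)
  show ?thesis using *[of u u'] *[of u' u] assms by fastforce
qed

text \<open>Both forces take place at the birth of \<open>u\<close>, where the second condition on a
  relaxed chronology applies.\<close>

lemma forced_left_unique:
  assumes "forced v u" "forced v' u"
  shows "v = v'"
  using assms chron unfolding forced_iff relaxed_chronology_def by blast

lemma B_subset: "B \<subseteq> verts G"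
  using blue_mono[of 0 K B F] by (simp add: blue_0 blue_K)

lemma in_B_iff: "v \<in> verts G \<Longrightarrow> v \<in> B \<longleftrightarrow> birth v = 0"
  using birth_le_iff[of v 0] by (simp add: blue_0)

lemma birth_pos_forced:
  assumes "v \<in> verts G" "v \<notin> B"
  shows "\<exists>w. forced w v"
proof -
  obtain k where k: "birth v = Suc k" using assms in_B_iff by (cases "birth v") auto
  have "v \<in> blue_at (Suc k)" "v \<notin> blue_at k"
    using k birth_le_iff[OF assms(1), of k] birth_le_iff[OF assms(1), of "Suc k"] by auto
  then have "\<exists>w. (w, v) \<in> F (birth v)" using k by (auto simp: blue_Suc)
  then show ?thesis using k birth_le_K[OF assms(1)] by (auto simp: forced_iff)
qed

section \<open>Active times as intervals\<close>

lemma in_act_iff: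
  assumes "v \<in> verts G"
  shows "k \<in> act B K F v \<longleftrightarrow> k \<le> K \<and> birth v \<le> k \<and> (\<forall>u. forced v u \<longrightarrow> k < birth u)"
proof -
  \<comment> \<open>The time of a force is the birth of its head, so forcing by time
    \<open>k\<close> means having a forced successor born by time \<open>k\<close>.\<close>
  have "(\<exists>j\<in>{1..k}. \<exists>u. (v, u) \<in> F j) \<longleftrightarrow> (\<exists>u. forced v u \<and> birth u \<le> k)" if "k \<le> K"
  proof
    assume "\<exists>j\<in>{1..k}. \<exists>u. (v, u) \<in> F j"
    then obtain j u where j: "j \<in> {1..k}" "(v, u) \<in> F j" by blast
    then have j': "j \<in> {1..K}" using that by simp
    then have "forced v u" using j(2) unfolding all_forces_def by blast
    moreover have "birth u = j" using force_birth(5)[OF j' j(2)] .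
    ultimately show "\<exists>u. forced v u \<and> birth u \<le> k" using j(1) by auto
  next
    assume "\<exists>u. forced v u \<and> birth u \<le> k"
    then obtain u where u: "forced v u" "birth u \<le> k" by blast
    then have "birth u \<in> {1..k}" "(v, u) \<in> F (birth u)" by (auto simp: forced_iff)
    then show "\<exists>j\<in>{1..k}. \<exists>u. (v, u) \<in> F j" by blast
  qed
  then show ?thesis
    unfolding act_def birth_le_iff[OF assms] mem_Collect_eq atLeastAtMost_iff not_le[symmetric]
    by blast
qed

lemma act_forced:
  assumes "forced v u"
  shows "act B K F v = {birth v..<birth u}"
proof (rule set_eqI)
  fix k
  have "forced v u' \<longleftrightarrow> u' = u" for u' using assms forced_right_unique by blast
  then show "k \<in> act B K F v \<longleftrightarrow> k \<in> {birth v..<birth u}"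
    using in_act_iff[OF forcedD(1)[OF assms], of k] birth_le_K[OF forcedD(2)[OF assms]] by auto
qed

lemma act_terminal:
  assumes "v \<in> verts G" "\<And>u. \<not> forced v u"
  shows "act B K F v = {birth v..K}"
  using in_act_iff[OF assms(1)] assms(2) by auto

text \<open>When \<open>v\<close> performs its force, all its other neighbours, \<open>w\<close>
  among them, have been born strictly earlier. Hence \<open>v\<close> is still active at the birth
  of \<open>w\<close>.\<close>

lemma birth_in_act:
  assumes "v \<rightarrow>\<^bsub>G\<^esub> w" "birth v \<le> birth w" "\<not> forced v w"
  shows "birth w \<in> act B K F v"
proof -
  have v: "v \<in> verts G" and w: "w \<in> verts G" using adj_in_verts[OF assms(1)] .
  have "birth w < birth u" if u: "forced v u" for u
  proof -
    have "w = u \<or> birth w < birth u"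
      using u by (intro force_birth(6)[OF _ _ assms(1)]) (simp_all add: forced_iff)
    then show ?thesis using u assms(3) by blast
  qed
  then show ?thesis using in_act_iff[OF v] birth_le_K[OF w] assms(2) by blast
qed

lemma birth_in_own_act:
  assumes "v \<in> verts G"
  shows "birth v \<in> act B K F v"
  using in_act_iff[OF assms] birth_le_K[OF assms] forcedD(4) by blast

text \<open>The birth of the later-born end is a common active time: that end is active at its own
  birth, the other one by \<open>birth_in_act\<close>.\<close>

lemma act_meet:
  assumes "v \<rightarrow>\<^bsub>G\<^esub> w" "\<not> forced v w" "\<not> forced w v"
  shows "act B K F v \<inter> act B K F w \<noteq> {}"
proof (cases "birth v \<le> birth w")
  case True
  then show ?thesis
    using birth_in_act[OF assms(1) _ assms(2)] birth_in_own_act adj_in_verts(2)[OF assms(1)] by blast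
next
  case False
  have "w \<rightarrow>\<^bsub>G\<^esub> v" using sym_arcs assms(1) by (rule arcs_ends_symmetric)
  then have "birth v \<in> act B K F w" using birth_in_act assms(3) False by simp
  then show ?thesis using birth_in_own_act adj_in_verts(1)[OF assms(1)] by blast
qed

section \<open>Forcing chains partition the vertices\<close>

abbreviation is_chain :: "'a list \<Rightarrow> bool" where "is_chain \<equiv> forcing_chain B K F"

lemma chain_forced:
  assumes "is_chain c" "Suc j < length c"
  shows "forced (c ! j) (c ! Suc j)"
  using assms successively_nth unfolding forcing_chain_def by fastforce

lemma chain_in_verts:
  assumes "is_chain c"
  shows "set c \<subseteq> verts G"
proof
  fix x assume "x \<in> set c"
  then obtain j where j: "j < length c" "x = c ! j" by (auto simp: in_set_conv_nth)
  show "x \<in> verts G"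
  proof (cases j)
    case 0
    then show ?thesis using assms j B_subset by (auto simp: forcing_chain_def hd_conv_nth)
  next
    case (Suc i)
    then show ?thesis using chain_forced[OF assms, of i] forcedD(2) j by simp
  qed
qed

lemma chain_birth_less:
  assumes "is_chain c" "a < b" "b < length c"
  shows "birth (c ! a) < birth (c ! b)"
proof -
  have "successively (\<lambda>x y. birth x < birth y) c"
    using assms(1) forcedD(4) unfolding forcing_chain_def by (auto elim: successively_mono)
  then have "sorted_wrt (\<lambda>x y. birth x < birth y) c"
    by (subst (asm) successively_conv_sorted_wrt) (simp_all add: transp_def)
  then show ?thesis using assms(2,3) by (auto simp: sorted_wrt_iff_nth_less)
qed

lemma chain_distinct: "is_chain c \<Longrightarrow> distinct c"
  unfolding distinct_conv_nth using chain_birth_less by (metis less_irrefl linorder_neqE_nat)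

lemma chain_unique_hd:
  assumes "is_chain c" "is_chain d" "hd c = hd d"
  shows "c = d"
  using successively_terminal_unique[of forced c d] assms forced_right_unique
  unfolding forcing_chain_def by blast

text \<open>From a common vertex, left-uniqueness of forces leads back along both chains through the
  same vertices, down to a common head. The head then determines the chain.\<close>

lemma chain_unique:
  assumes "is_chain c" "is_chain d" "x \<in> set c" "x \<in> set d"
  shows "c = d"
proof -
  have *: "hd c = hd d"
    if "is_chain c" "is_chain d" "i < length c" "j < length d" "c ! i = d ! j" "i \<le> j" for c d i j
    using that
  proof (induction i arbitrary: j)
    case 0
    have "c \<noteq> []" "d \<noteq> []" using 0 by auto
    \<comment> \<open>The chain \<open>c\<close> has reached its start, a vertex of
      \<open>B\<close>. It is born at time 0 and so is never forced; therefore \<open>d\<close> is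
      at its start as well.\<close>
    have "j = 0"
    proof (rule ccontr)
      assume "j \<noteq> 0"
      then obtain k where "j = Suc k" by (cases j) auto
      then have "forced (d ! k) (c ! 0)" using chain_forced[OF 0(2), of k] 0 by simp
      then have "0 < birth (c ! 0)" "c ! 0 \<in> verts G" using forcedD by auto
      moreover have "c ! 0 \<in> B" using 0 \<open>c \<noteq> []\<close> by (auto simp: forcing_chain_def hd_conv_nth)
      ultimately show False using in_B_iff by auto
    qed
    then show ?case using 0 \<open>c \<noteq> []\<close> \<open>d \<noteq> []\<close> by (simp add: hd_conv_nth)
  next
    case (Suc i)
    then obtain k where k: "j = Suc k" by (cases j) auto
    have "forced (c ! i) (c ! Suc i)" "forced (d ! k) (c ! Suc i)"
      using chain_forced[OF Suc.prems(1,3)] chain_forced[of d k] Suc.prems k by simp_all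
    then have "c ! i = d ! k" by (rule forced_left_unique)
    then show ?case using Suc.IH[of k] Suc.prems k by simp
  qed
  obtain i j where ij: "i < length c" "j < length d" "c ! i = d ! j"
    using assms(3,4) by (metis in_set_conv_nth)
  have "hd c = hd d"
  proof (cases "i \<le> j")
    case True
    then show ?thesis using *[of c d i j] assms ij by simp
  next
    case False
    then show ?thesis using *[of d c j i] assms ij by simp
  qed
  then show ?thesis using chain_unique_hd assms by blast
qed

text \<open>Forces strictly increase births, which are bounded by \<open>K\<close>. Following them
  forward from \<open>v\<close> ends at a terminal vertex (induction on \<open>K - birth v\<close>);
  following them backward ends in \<open>B\<close> (induction on \<open>birth v\<close>).\<close>

lemma chain_exists:
  assumes "v \<in> verts G"
  shows "\<exists>c. is_chain c \<and> v \<in> set c"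
proof -
  \<comment> \<open>A forcing chain that may start outside \<open>B\<close>, so that it can grow at
    the front.\<close>
  define good where "good xs \<longleftrightarrow> xs \<noteq> [] \<and> successively forced xs \<and> (\<forall>u. \<not> forced (last xs) u)" for xs
  have "\<exists>xs. good xs \<and> hd xs = v"
    using assms
  proof (induction "K - birth v" arbitrary: v rule: less_induct)
    case less
    show ?case
    proof (cases "\<exists>u. forced v u")
      case True
      then obtain u where u: "forced v u" by blast
      then have "K - birth u < K - birth v" using forcedD[OF u] birth_le_K by fastforce
      then obtain xs where "good xs" "hd xs = u" using less.hyps forcedD(2)[OF u] by blast
      then have "good (v # xs)" using u by (auto simp: good_def successively_Cons)
      then show ?thesis by (metis list.sel(1))
    next
      case False
      then have "good [v]" by (simp add: good_def)
      then show ?thesis by (metis list.sel(1))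
    qed
  qed
  then obtain xs where "good xs" "hd xs = v" by blast
  then show ?thesis
    using assms
  proof (induction "birth v" arbitrary: v xs rule: less_induct)
    case less
    show ?case
    proof (cases "v \<in> B")
      case True
      then have "is_chain xs" using less.prems by (auto simp: good_def forcing_chain_def)
      then show ?thesis using less.prems by (auto simp: good_def)
    next
      case False
      then obtain w where w: "forced w v" using birth_pos_forced less.prems by blast
      then have "good (w # xs)" using less.prems by (auto simp: good_def successively_Cons)
      then obtain c where c: "is_chain c" "w \<in> set c"
        using less.hyps[of w "w # xs"] forcedD[OF w] by auto
      then obtain j where j: "j < length c" "w = c ! j" by (metis in_set_conv_nth)
      \<comment> \<open>The vertex \<open>w\<close> forces \<open>v\<close>, so it cannot end
        \<open>c\<close>; its successor in \<open>c\<close> is then \<open>v\<close> by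
        right-uniqueness.\<close>
      have "Suc j < length c"
      proof (rule ccontr)
        assume "\<not> Suc j < length c"
        then have "j = length c - 1" using j(1) by simp
        then have "last c = w" using j by (metis last_conv_nth length_0_conv not_less_zero)
        then show False using c(1) w by (auto simp: forcing_chain_def)
      qed
      then show ?thesis
        using chain_forced[OF c(1), of j] forced_right_unique[OF w] j c(1) nth_mem by fastforce
    qed
  qed
qed

section \<open>The chain set as a path cover with its witness\<close>

lemma chain_act:
  assumes "is_chain c" "j < length c"
  shows "act B K F (c ! j) =
    {birth (c ! j)..<(if Suc j < length c then birth (c ! Suc j) else Suc K)}"
proof (cases "Suc j < length c")
  case True
  then show ?thesis using act_forced chain_forced[OF assms(1)] by simp
next
  case False
  then have "j = length c - 1" using assms(2) by simp
  then have "c ! j = last c" using assms(2) by (metis last_conv_nth length_0_conv not_less_zero)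
  then have "\<And>u. \<not> forced (c ! j) u" using assms(1) by (simp add: forcing_chain_def)
  moreover have "c ! j \<in> verts G" using chain_in_verts[OF assms(1)] nth_mem[OF assms(2)] by blast
  ultimately have "act B K F (c ! j) = {birth (c ! j)..K}" using act_terminal by blast
  then show ?thesis using False by (simp add: atLeastLessThanSuc_atLeastAtMost)
qed

text \<open>The births along the chain serve as start times. The value \<open>Suc K\<close> past the
  end reflects that the terminal vertex stays active through time \<open>K\<close>.\<close>

lemma chain_block_partition:
  assumes "is_chain c"
  shows "block_partition K (length c) (\<lambda>j. act B K F (c ! j))"
proof (rule block_partitionI[where s = "\<lambda>j. if j < length c then birth (c ! j) else Suc K"])
  have ne: "c \<noteq> []" using assms by (simp add: forcing_chain_def)
  then have "c ! 0 \<in> B" using assms by (simp add: forcing_chain_def hd_conv_nth)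
  then have "birth (c ! 0) = 0" using in_B_iff B_subset by blast
  then show "(if 0 < length c then birth (c ! 0) else Suc K) = 0" using ne by simp
next
  fix j assume j: "j < length c"
  have "c ! j \<in> verts G" using chain_in_verts[OF assms] j nth_mem by blast
  then show "(if j < length c then birth (c ! j) else Suc K)
      < (if Suc j < length c then birth (c ! Suc j) else Suc K)"
    using chain_birth_less[OF assms, of j "Suc j"] birth_le_K[of "c ! j"] j by auto
  show "act B K F (c ! j) = {if j < length c then birth (c ! j) else Suc K..<
      if Suc j < length c then birth (c ! Suc j) else Suc K}"
    using chain_act[OF assms j] j by simp
qed simp

text \<open>A chord would keep \<open>c ! a\<close> active until the birth of \<open>c ! b\<close>,
  but its activity ends already at the birth of its successor \<open>c ! Suc a\<close>.\<close>

lemma chain_adj: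
  assumes "is_chain c" "a < b" "b < length c"
  shows "c ! a \<rightarrow>\<^bsub>G\<^esub> c ! b \<longleftrightarrow> b = Suc a"
proof
  assume adj: "c ! a \<rightarrow>\<^bsub>G\<^esub> c ! b"
  show "b = Suc a"
  proof (rule ccontr)
    assume nb: "b \<noteq> Suc a"
    have f: "forced (c ! a) (c ! Suc a)" using chain_forced[OF assms(1)] assms by simp
    have less: "birth (c ! Suc a) < birth (c ! b)" using chain_birth_less[OF assms(1)] assms nb by simp
    then have "\<not> forced (c ! a) (c ! b)" using forced_right_unique[OF f] by fastforce
    then have "birth (c ! b) \<in> act B K F (c ! a)"
      using birth_in_act[OF adj] chain_birth_less[OF assms] by simp
    then show False using act_forced[OF f] less by simp
  qed
qed (use chain_forced[OF assms(1), of a] forcedD(3) assms(3) in simp)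

lemma chain_path_order:
  assumes "is_chain c"
  shows "path_order (G \<restriction> set c) c"
  unfolding path_order_def
proof (intro conjI allI impI)
  show "c \<noteq> []" using assms by (simp add: forcing_chain_def)
  show "distinct c" using assms by (rule chain_distinct)
  fix a b assume ab: "a < length c" "b < length c"
  have sym: "c ! a \<rightarrow>\<^bsub>G\<^esub> c ! b \<longleftrightarrow> c ! b \<rightarrow>\<^bsub>G\<^esub> c ! a"
    using arcs_ends_symmetric[OF sym_arcs] by blast
  have "c ! a \<rightarrow>\<^bsub>G\<^esub> c ! b \<longleftrightarrow> \<bar>int a - int b\<bar> = 1"
  proof (cases a b rule: linorder_cases)
    case less
    then show ?thesis using chain_adj[OF assms less] ab by auto
  next
    case equal
    then show ?thesis using adj_not_same by auto
  next
    case greater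
    then show ?thesis using chain_adj[OF assms greater] ab sym by auto
  qed
  then show "c ! a \<rightarrow>\<^bsub>G \<restriction> set c\<^esub> c ! b \<longleftrightarrow> \<bar>int a - int b\<bar> = 1"
    using ab by (simp add: adj_induce_subgraph)
qed simp

lemma chain_set_path_cover: "path_cover G (chain_set G B K F)"
  unfolding path_cover_def
proof (intro conjI ballI)
  fix P assume "P \<in> chain_set G B K F"
  then obtain c where c: "P = G \<restriction> set c" "is_chain c" by (auto simp: chain_set_def)
  then show "induced_path G P"
    unfolding induced_path_def
    using chain_path_order[OF c(2)] induced_induce[OF chain_in_verts[OF c(2)]] by blast
next
  fix v assume "v \<in> verts G"
  then obtain c where c: "is_chain c" "v \<in> set c" using chain_exists by blast
  show "\<exists>!P. P \<in> chain_set G B K F \<and> v \<in> verts P"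
  proof (rule ex1I[of _ "G \<restriction> set c"])
    show "G \<restriction> set c \<in> chain_set G B K F \<and> v \<in> verts (G \<restriction> set c)"
      using c by (auto simp: chain_set_def)
    fix P assume "P \<in> chain_set G B K F \<and> v \<in> verts P"
    then obtain d where d: "P = G \<restriction> set d" "is_chain d" "v \<in> set d" by (auto simp: chain_set_def)
    then show "P = G \<restriction> set c" using chain_unique[OF d(2) c(1) d(3) c(2)] by simp
  qed
qed

lemma chain_labelling:
  assumes "bij_betw v {1..m} {c. is_chain c}"
  shows "path_labelling (chain_set G B K F) m v"
  unfolding path_labelling_def
proof (intro exI conjI ballI)
  \<comment> \<open>Chains with the same vertex set share a vertex and hence coincide; so
    enumerating chains also enumerates their induced subgraphs without repetition.\<close>
  have inj: "inj_on (\<lambda>c. G \<restriction> set c) {c. is_chain c}"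
  proof (rule inj_onI)
    fix c d assume c: "c \<in> {c. is_chain c}" and d: "d \<in> {c. is_chain c}"
      and eq: "G \<restriction> set c = G \<restriction> set d"
    have "set c = set d" using arg_cong[OF eq, of verts] by simp
    moreover have "hd c \<in> set c" using c by (simp add: forcing_chain_def)
    ultimately show "c = d" using chain_unique c d by blast
  qed
  have "(\<lambda>c. G \<restriction> set c) ` {c. is_chain c} = chain_set G B K F" by (auto simp: chain_set_def)
  then have "bij_betw (\<lambda>c. G \<restriction> set c) {c. is_chain c} (chain_set G B K F)"
    using inj by (simp add: bij_betw_def)
  from bij_betw_trans[OF assms this]
  show "bij_betw ((\<lambda>c. G \<restriction> set c) \<circ> v) {1..m} (chain_set G B K F)" .
  fix i assume "i \<in> {1..m}"
  then have "is_chain (v i)" using bij_betwE[OF assms] by blast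
  then show "path_order (((\<lambda>c. G \<restriction> set c) \<circ> v) i) (v i)" using chain_path_order by simp
qed

text \<open>Distinct chains are disjoint and no force leads from one to another, so
  \<open>act_meet\<close> applies to every edge between them.\<close>

lemma chain_witness:
  assumes "bij_betw v {1..m} {c. is_chain c}"
  shows "pip_witness G m v K (\<lambda>i j. act B K F (v i ! j))"
proof -
  have ch: "is_chain (v i)" if "i \<in> {1..m}" for i using bij_betwE[OF assms] that by blast
  have "act B K F (v i1 ! j1) \<inter> act B K F (v i2 ! j2) \<noteq> {}"
    if i: "i1 \<in> {1..m}" "i2 \<in> {1..m}" "i1 \<noteq> i2" and j: "j1 < length (v i1)" "j2 < length (v i2)"
      and adj: "v i1 ! j1 \<rightarrow>\<^bsub>G\<^esub> v i2 ! j2" for i1 i2 j1 j2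
  proof -
    have "v i1 \<noteq> v i2" using inj_onD[OF bij_betw_imp_inj_on[OF assms] _ i(1,2)] i(3) by blast
    then have disj: "set (v i1) \<inter> set (v i2) = {}"
      using chain_unique[OF ch[OF i(1)] ch[OF i(2)]] by blast
    \<comment> \<open>Chains are closed under forcing: the chain through \<open>y\<close> does not
      start at \<open>y\<close>, and the predecessor of \<open>y\<close> on it can only be
      \<open>x\<close>.\<close>
    have closed: "y \<in> set c" if "is_chain c" "x \<in> set c" "forced x y" for c x y
    proof -
      obtain d where d: "is_chain d" "y \<in> set d" using chain_exists forcedD(2) \<open>forced x y\<close> by blast
      then obtain k where k: "k < length d" "y = d ! k" by (metis in_set_conv_nth)
      have "k \<noteq> 0"
      proof
        assume "k = 0"
        then have "y \<in> B" using d k by (auto simp: forcing_chain_def hd_conv_nth)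
        then show False using in_B_iff forcedD[OF \<open>forced x y\<close>] by auto
      qed
      then obtain l where l: "k = Suc l" by (cases k) auto
      then have "forced (d ! l) y" using chain_forced[OF d(1), of l] k by simp
      then have "d ! l = x" using forced_left_unique \<open>forced x y\<close> by blast
      then have "x \<in> set d" using k l by auto
      then have "c = d" by (rule chain_unique[OF \<open>is_chain c\<close> d(1) \<open>x \<in> set c\<close>])
      then show ?thesis using d by simp
    qed
    have "v i1 ! j1 \<in> set (v i1)" "v i2 ! j2 \<in> set (v i2)" using j by auto
    then have "\<not> forced (v i1 ! j1) (v i2 ! j2)" "\<not> forced (v i2 ! j2) (v i1 ! j1)"
      using closed[OF ch[OF i(1)]] closed[OF ch[OF i(2)]] disj by blast+
    then show ?thesis by (rule act_meet[OF adj])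
  qed
  then show ?thesis unfolding pip_witness_def using ch chain_block_partition by simp
qed

lemma finite_chains: "finite {c. is_chain c}"
proof (rule finite_imageD)
  have "hd ` {c. is_chain c} \<subseteq> verts G" using B_subset by (auto simp: forcing_chain_def)
  then show "finite (hd ` {c. is_chain c})" by (rule finite_subset) simp
  show "inj_on hd {c. is_chain c}" using chain_unique_hd by (auto simp: inj_on_def)
qed

lemma chain_set_pip: "parallel_increasing_path_cover G (chain_set G B K F)"
proof -
  obtain v where "bij_betw v {1..card {c. is_chain c}} {c. is_chain c}"
    using ex_bij_betw_nat_finite_1[OF finite_chains] by blast
  then show ?thesis
    unfolding parallel_increasing_path_cover_def
    using chain_set_path_cover chain_labelling chain_witness by blast
qed

text \<open>The simultaneous forces of one time step are carried out one by one. By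
  \<open>forces_mono\<close> each remains valid after some of the other heads have turned
  blue.\<close>

lemma zero_forcing: "zero_forcing_set G B"
proof -
  have "(force_step G)\<^sup>*\<^sup>* B (blue_at k)" if "k \<le> K" for k
    using that
  proof (induction k)
    case 0
    then show ?case by (simp add: blue_0)
  next
    case (Suc k)
    let ?N = "{u. \<exists>v. (v, u) \<in> F (Suc k)}"
    have sub: "F (Suc k) \<subseteq> forces G (blue_at k)"
      using F_subset_forces[of "Suc k"] Suc.prems by simp
    then have "?N \<subseteq> verts G" by (auto simp: forces_iff)
    then have "finite ?N" by (rule finite_subset) simp
    have "(force_step G)\<^sup>*\<^sup>* B (blue_at k \<union> U)" if "finite U" "U \<subseteq> ?N" for U
      using that
    proof (induction U)
      case empty
      then show ?case using Suc by simp
    next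
      case (insert u U)
      then obtain v where v: "(v, u) \<in> forces G (blue_at k)" using sub by blast
      then have "u \<notin> blue_at k" by (simp add: forces_iff)
      then have "(v, u) \<in> forces G (blue_at k \<union> U)"
        using insert.hyps(2) by (intro forces_mono[OF v]) simp_all
      then have "force_step G (blue_at k \<union> U) (blue_at k \<union> insert u U)"
        by (auto simp: force_step_def)
      moreover have "(force_step G)\<^sup>*\<^sup>* B (blue_at k \<union> U)" using insert by simp
      ultimately show ?case by (rule rtranclp.rtrancl_into_rtrancl[rotated])
    qed
    from this[OF \<open>finite ?N\<close> subset_refl] show ?case unfolding blue_Suc .
  qed
  from this[of K] show ?thesis unfolding zero_forcing_set_def using B_subset blue_K by simp
qed

end

section \<open>The relaxed chronology of a witness\<close>

text \<open>Here \<open>S i j\<close> is the start time of the block of \<open>v i ! j\<close>, with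
  sentinel \<open>Suc K\<close> past the end. Taken in both directions of an edge,
  \<open>S_cross\<close> says that the two half-open blocks intersect.\<close>

locale pip_start_times = graph G for G :: "('a, 'b) pre_digraph" +
  fixes m :: nat and v :: "nat \<Rightarrow> 'a list" and K :: nat and S :: "nat \<Rightarrow> nat \<Rightarrow> nat"
  assumes nonempty: "i \<in> {1..m} \<Longrightarrow> v i \<noteq> []"
    and position_unique: "\<lbrakk>i \<in> {1..m}; i' \<in> {1..m}; j < length (v i); j' < length (v i');
      v i ! j = v i' ! j'\<rbrakk> \<Longrightarrow> i = i' \<and> j = j'"
    and verts_eq: "verts G = (\<Union>i\<in>{1..m}. set (v i))"
    and path_adj: "\<lbrakk>i \<in> {1..m}; a < length (v i); b < length (v i)\<rbrakk> \<Longrightarrow>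
      v i ! a \<rightarrow>\<^bsub>G\<^esub> v i ! b \<longleftrightarrow> \<bar>int a - int b\<bar> = 1"
    and S_0: "i \<in> {1..m} \<Longrightarrow> S i 0 = 0"
    and S_length: "i \<in> {1..m} \<Longrightarrow> S i (length (v i)) = Suc K"
    and S_less_Suc: "\<lbrakk>i \<in> {1..m}; j < length (v i)\<rbrakk> \<Longrightarrow> S i j < S i (Suc j)"
    and S_cross: "\<lbrakk>i \<in> {1..m}; i' \<in> {1..m}; i \<noteq> i'; j < length (v i); j' < length (v i');
      v i ! j \<rightarrow>\<^bsub>G\<^esub> v i' ! j'\<rbrakk> \<Longrightarrow> S i' j' < S i (Suc j)"
begin

definition B :: "'a set" where
  "B = {v i ! 0 | i. i \<in> {1..m}}"

text \<open>A block ends where the next one starts, so forcing at that moment makes the active times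
  agree with the prescribed blocks.\<close>

definition F :: "nat \<Rightarrow> ('a \<times> 'a) set" where
  "F k = {(v i ! j, v i ! Suc j) | i j. i \<in> {1..m} \<and> Suc j < length (v i) \<and> S i (Suc j) = k}"

lemma S_mono:
  assumes "i \<in> {1..m}" "a < b" "b \<le> length (v i)"
  shows "S i a < S i b"
  using assms(2,3)
proof (induction b)
  case (Suc b)
  have "S i b < S i (Suc b)" using Suc.prems S_less_Suc[OF assms(1)] by simp
  then show ?case using Suc by (cases "a = b") auto
qed simp

lemma S_le_K:
  assumes "i \<in> {1..m}" "j < length (v i)"
  shows "S i j \<le> K"
  using S_mono[OF assms(1), of j "length (v i)"] S_length[OF assms(1)] assms(2) by simp

lemma S_eq_0_iff:
  assumes "i \<in> {1..m}" "j \<le> length (v i)"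
  shows "S i j = 0 \<longleftrightarrow> j = 0"
  using S_mono[OF assms(1), of 0 j] S_0[OF assms(1)] assms(2) by (cases j) auto

lemma in_vertsE:
  assumes "x \<in> verts G"
  obtains i j where "i \<in> {1..m}" "j < length (v i)" "x = v i ! j"
  using assms unfolding verts_eq by (metis UN_E in_set_conv_nth)

lemma blue_eq: "blue B F k = {v i ! j | i j. i \<in> {1..m} \<and> j < length (v i) \<and> S i j \<le> k}"
proof (induction k)
  case 0
  have "x \<in> B \<longleftrightarrow> x \<in> {v i ! j | i j. i \<in> {1..m} \<and> j < length (v i) \<and> S i j \<le> 0}" for x
  proof
    assume "x \<in> B"
    then obtain i where "i \<in> {1..m}" "x = v i ! 0" by (auto simp: B_def)
    then show "x \<in> {v i ! j | i j. i \<in> {1..m} \<and> j < length (v i) \<and> S i j \<le> 0}"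
      using S_0 nonempty by fastforce
  next
    assume "x \<in> {v i ! j | i j. i \<in> {1..m} \<and> j < length (v i) \<and> S i j \<le> 0}"
    then obtain i j where "i \<in> {1..m}" "j < length (v i)" "S i j = 0" "x = v i ! j" by auto
    then show "x \<in> B" using S_eq_0_iff[of i j] unfolding B_def by auto
  qed
  then show ?case unfolding blue_0 by blast
next
  case (Suc k)
  have "(\<exists>w. (w, x) \<in> F (Suc k)) \<longleftrightarrow>
      (\<exists>i j. x = v i ! j \<and> i \<in> {1..m} \<and> j < length (v i) \<and> S i j = Suc k)" for x
  proof
    assume "\<exists>w. (w, x) \<in> F (Suc k)"
    then show "\<exists>i j. x = v i ! j \<and> i \<in> {1..m} \<and> j < length (v i) \<and> S i j = Suc k"
      unfolding F_def by blast
  next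
    assume "\<exists>i j. x = v i ! j \<and> i \<in> {1..m} \<and> j < length (v i) \<and> S i j = Suc k"
    then obtain i j where ij: "x = v i ! j" "i \<in> {1..m}" "j < length (v i)" "S i j = Suc k" by blast
    \<comment> \<open>A positive start time rules out the first position, so there is a predecessor
      on the path to do the forcing.\<close>
    then obtain l where "j = Suc l" using S_0[OF ij(2)] by (cases j) auto
    then show "\<exists>w. (w, x) \<in> F (Suc k)" using ij unfolding F_def by blast
  qed
  then show ?case unfolding blue_Suc Suc.IH le_Suc_eq by blast
qed

lemma in_blue_iff:
  assumes "i \<in> {1..m}" "j < length (v i)"
  shows "v i ! j \<in> blue B F k \<longleftrightarrow> S i j \<le> k"
proof
  assume "v i ! j \<in> blue B F k"
  then obtain i' j' where *: "i' \<in> {1..m}" "j' < length (v i')" "S i' j' \<le> k" "v i ! j = v i' ! j'"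
    unfolding blue_eq by blast
  then show "S i j \<le> k" using position_unique[OF assms(1) *(1) assms(2) *(2,4)] by simp
qed (use assms blue_eq in blast)

text \<open>On its own path, \<open>x\<close> has besides \<open>y\<close> at most its predecessor
  as neighbour, which started earlier. A neighbour on another path starts before the block of
  \<open>x\<close> ends, that is, before \<open>k\<close>, by \<open>S_cross\<close>.\<close>

lemma F_forces: "F k \<subseteq> forces G (blue B F (k - 1))"
proof (rule subrelI)
  fix x y assume "(x, y) \<in> F k"
  then obtain i j where x: "x = v i ! j" and y: "y = v i ! Suc j"
    and i: "i \<in> {1..m}" and j: "Suc j < length (v i)" and k: "S i (Suc j) = k"
    unfolding F_def by blast
  \<comment> \<open>In particular \<open>k\<close> is positive, so the subtraction in
    \<open>k - 1\<close> is not truncated.\<close>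
  have less: "S i j < k" using S_less_Suc[OF i, of j] j k by simp
  have "w = y \<or> w \<in> blue B F (k - 1)" if w: "w \<in> verts G" and adj: "x \<rightarrow>\<^bsub>G\<^esub> w" for w
  proof -
    obtain i' j' where w': "i' \<in> {1..m}" "j' < length (v i')" "w = v i' ! j'" using in_vertsE[OF w] .
    show ?thesis
    proof (cases "i' = i")
      case True
      then have "j' = Suc j \<or> Suc j' = j"
        using path_adj[OF i, of j j'] adj x w' j by auto
      then show ?thesis
      proof
        assume "Suc j' = j"
        then have "S i j' < S i j" using S_mono[OF i, of j' j] j by simp
        then have "S i' j' \<le> k - 1" using less unfolding True by linarith
        then show ?thesis using w' in_blue_iff[OF w'(1,2)] by simp
      qed (use True w' y in simp)
    next
      case False
      then have "S i' j' < S i (Suc j)" using S_cross[OF i w'(1)] w' j adj x by simp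
      then have "S i' j' \<le> k - 1" using k by linarith
      then show ?thesis using w' in_blue_iff[OF w'(1,2)] by simp
    qed
  qed
  moreover have "x \<rightarrow>\<^bsub>G\<^esub> y" using path_adj[OF i, of j "Suc j"] j x y by simp
  moreover have "x \<in> blue B F (k - 1)" using less in_blue_iff[OF i, of j] j x by simp
  moreover have "y \<notin> blue B F (k - 1)" using less k in_blue_iff[OF i j] y by simp
  ultimately show "(x, y) \<in> forces G (blue B F (k - 1))" by (auto simp: forces_iff)
qed

lemma F_left_unique:
  assumes "(w, x) \<in> F k" "(w', x) \<in> F k"
  shows "w = w'"
proof -
  obtain i j where ij: "w = v i ! j" "x = v i ! Suc j" "i \<in> {1..m}" "Suc j < length (v i)"
    using assms(1) unfolding F_def by blast
  obtain i' j' where ij': "w' = v i' ! j'" "x = v i' ! Suc j'" "i' \<in> {1..m}" "Suc j' < length (v i')"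
    using assms(2) unfolding F_def by blast
  show ?thesis using position_unique[OF ij(3) ij'(3) ij(4) ij'(4)] ij ij' by simp
qed

lemma F_relaxed_chronology: "relaxed_chronology G B K F"
proof -
  have "blue B F K \<subseteq> verts G" unfolding blue_eq verts_eq by auto
  moreover have "x \<in> blue B F K" if x: "x \<in> verts G" for x
  proof -
    obtain i j where "i \<in> {1..m}" "j < length (v i)" "x = v i ! j" using in_vertsE[OF x] .
    then show ?thesis using in_blue_iff S_le_K by simp
  qed
  ultimately show ?thesis
    unfolding relaxed_chronology_def using F_forces F_left_unique by blast
qed

section \<open>Chains and active times of the constructed chronology\<close>

sublocale chronology G B K F
  by unfold_locales (rule F_relaxed_chronology)

lemma forced_v_iff:
  "forced x y \<longleftrightarrow> (\<exists>i j. x = v i ! j \<and> y = v i ! Suc j \<and> i \<in> {1..m} \<and> Suc j < length (v i))"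
proof
  assume "forced x y"
  then show "\<exists>i j. x = v i ! j \<and> y = v i ! Suc j \<and> i \<in> {1..m} \<and> Suc j < length (v i)"
    unfolding all_forces_def F_def by blast
next
  assume "\<exists>i j. x = v i ! j \<and> y = v i ! Suc j \<and> i \<in> {1..m} \<and> Suc j < length (v i)"
  then obtain i j where ij: "x = v i ! j" "y = v i ! Suc j" "i \<in> {1..m}" "Suc j < length (v i)" by blast
  then have "S i (Suc j) \<in> {1..K}" using S_le_K S_eq_0_iff[of i "Suc j"] by (auto simp: Suc_le_eq)
  moreover have "(x, y) \<in> F (S i (Suc j))" using ij unfolding F_def by blast
  ultimately show "forced x y" unfolding all_forces_def by blast
qed

lemma v_chain:
  assumes i: "i \<in> {1..m}"
  shows "is_chain (v i)"
proof -
  have ne: "v i \<noteq> []" using nonempty i .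
  have "\<not> forced (last (v i)) y" for y
  proof
    assume "forced (last (v i)) y"
    then obtain i' j where *: "last (v i) = v i' ! j" "i' \<in> {1..m}" "Suc j < length (v i')"
      unfolding forced_v_iff by blast
    \<comment> \<open>The last vertex of \<open>v i\<close> occurs at no other position, so it has
      no successor in any list.\<close>
    have "i = i' \<and> length (v i) - 1 = j"
      by (rule position_unique) (use i * ne in \<open>auto simp: last_conv_nth\<close>)
    then show False using * by auto
  qed
  moreover have "hd (v i) \<in> B" unfolding B_def using i ne by (auto simp: hd_conv_nth)
  moreover have "successively forced (v i)"
    unfolding successively_conv_nth forced_v_iff using i by blast
  ultimately show ?thesis using ne unfolding forcing_chain_def by blast
qed

text \<open>Every vertex of \<open>B\<close> is the head of some \<open>v i\<close>, and a chain is
  determined by its head.\<close>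

lemma chains_eq: "{c. is_chain c} = v ` {1..m}"
proof
  show "{c. is_chain c} \<subseteq> v ` {1..m}"
  proof
    fix c assume "c \<in> {c. is_chain c}"
    then have c: "is_chain c" by simp
    then have "hd c \<in> B" by (simp add: forcing_chain_def)
    then obtain i where i: "i \<in> {1..m}" "hd c = v i ! 0" unfolding B_def by blast
    then have "c = v i" using chain_unique_hd[OF c v_chain] nonempty by (simp add: hd_conv_nth)
    then show "c \<in> v ` {1..m}" using i by blast
  qed
qed (use v_chain in blast)

lemma birth_v:
  assumes "i \<in> {1..m}" "j < length (v i)"
  shows "birth (v i ! j) = S i j"
proof -
  have "v i ! j \<in> verts G" unfolding verts_eq using assms nth_mem by blast
  then have "birth (v i ! j) \<le> k \<longleftrightarrow> S i j \<le> k" for k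
    using birth_le_iff in_blue_iff[OF assms] by simp
  then show ?thesis by (metis order_antisym order_refl)
qed

lemma act_v:
  assumes "i \<in> {1..m}" "j < length (v i)"
  shows "act B K F (v i ! j) = {S i j..<S i (Suc j)}"
proof (cases "Suc j < length (v i)")
  case True
  then show ?thesis using chain_act[OF v_chain assms(2)] assms birth_v by simp
next
  case False
  then have "Suc j = length (v i)" using assms(2) by simp
  then show ?thesis using chain_act[OF v_chain assms(2)] assms birth_v S_length[of i] by simp
qed

end

section \<open>From labelled path covers and witnesses to chronologies\<close>

lemma labelled_cover:
  assumes "graph G" "path_cover G Q" "path_labelling Q m v"
  shows "Q = (\<lambda>i. G \<restriction> set (v i)) ` {1..m}"
    and "\<And>i. i \<in> {1..m} \<Longrightarrow> v i \<noteq> []"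
    and "\<And>i i' j j'. \<lbrakk>i \<in> {1..m}; i' \<in> {1..m}; j < length (v i); j' < length (v i');
      v i ! j = v i' ! j'\<rbrakk> \<Longrightarrow> i = i' \<and> j = j'"
    and "verts G = (\<Union>i\<in>{1..m}. set (v i))"
    and "\<And>i a b. \<lbrakk>i \<in> {1..m}; a < length (v i); b < length (v i)\<rbrakk> \<Longrightarrow>
      v i ! a \<rightarrow>\<^bsub>G\<^esub> v i ! b \<longleftrightarrow> \<bar>int a - int b\<bar> = 1"
proof -
  obtain P where bij: "bij_betw P {1..m} Q" and ord: "\<And>i. i \<in> {1..m} \<Longrightarrow> path_order (P i) (v i)"
    using assms(3) unfolding path_labelling_def by blast
  have PQ: "P i \<in> Q" if "i \<in> {1..m}" for i using bij that by (rule bij_betw_apply)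
  have ind: "induced_subgraph (P i) G" if "i \<in> {1..m}" for i
    using assms(2) PQ[OF that] unfolding path_cover_def induced_path_def by blast
  have vP: "verts (P i) = set (v i)" if "i \<in> {1..m}" for i using ord[OF that] by (simp add: path_order_def)
  \<comment> \<open>An induced subgraph is determined by its vertex set.\<close>
  have P_eq: "P i = G \<restriction> set (v i)" if "i \<in> {1..m}" for i
    using ind[OF that] vP[OF that]
    by (auto simp: induced_subgraph_def subgraph_def compatible_def intro!: pre_digraph.equality)
  show "Q = (\<lambda>i. G \<restriction> set (v i)) ` {1..m}"
    using bij_betw_imp_surj_on[OF bij] P_eq by auto
  show "v i \<noteq> []" if "i \<in> {1..m}" for i using ord[OF that] by (simp add: path_order_def)
  have sub: "set (v i) \<subseteq> verts G" if "i \<in> {1..m}" for i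
    using ind[OF that] vP[OF that] by (auto simp: induced_subgraph_def subgraph_def)
  show "verts G = (\<Union>i\<in>{1..m}. set (v i))"
  proof
    show "verts G \<subseteq> (\<Union>i\<in>{1..m}. set (v i))"
    proof
      fix x assume "x \<in> verts G"
      then obtain R where R: "R \<in> Q" "x \<in> verts R" using assms(2) unfolding path_cover_def by blast
      then obtain i where "i \<in> {1..m}" "R = P i" using bij_betw_imp_surj_on[OF bij] by blast
      then show "x \<in> (\<Union>i\<in>{1..m}. set (v i))" using R vP by blast
    qed
  qed (use sub in blast)
  show "i = i' \<and> j = j'"
    if i: "i \<in> {1..m}" "i' \<in> {1..m}" and j: "j < length (v i)" "j' < length (v i')"
      and eq: "v i ! j = v i' ! j'" for i i' j j'
  proof -
    \<comment> \<open>Unique covering identifies the two paths, injectivity of the enumeration their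
      indices, and distinctness of the list the two positions.\<close>
    have "v i ! j \<in> verts (P i)" "v i ! j \<in> verts (P i')"
      using vP[OF i(1)] vP[OF i(2)] nth_mem[OF j(1)] nth_mem[OF j(2)] eq by auto
    moreover have "v i ! j \<in> verts G" using sub[OF i(1)] j(1) by auto
    ultimately have "P i = P i'" using assms(2) PQ i unfolding path_cover_def by blast
    then have "i = i'" using inj_onD[OF bij_betw_imp_inj_on[OF bij]] i by blast
    moreover have "distinct (v i)" using ord[OF i(1)] by (simp add: path_order_def)
    ultimately show ?thesis using j eq nth_eq_iff_index_eq by blast
  qed
  show "v i ! a \<rightarrow>\<^bsub>G\<^esub> v i ! b \<longleftrightarrow> \<bar>int a - int b\<bar> = 1"
    if "i \<in> {1..m}" "a < length (v i)" "b < length (v i)" for i a b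
  proof -
    have "v i ! a \<rightarrow>\<^bsub>G \<restriction> set (v i)\<^esub> v i ! b \<longleftrightarrow> \<bar>int a - int b\<bar> = 1"
      using ord[OF that(1)] that(2,3) unfolding path_order_def P_eq[OF that(1)] by blast
    then show ?thesis using that(2,3) unfolding adj_induce_subgraph by simp
  qed
qed

lemma witness_chronology:
  assumes "graph G" "path_cover G Q" "path_labelling Q m v" "pip_witness G m v K A"
  shows "\<exists>B F. B = {v i ! 0 | i. i \<in> {1..m}} \<and>
    zero_forcing_set G B \<and> relaxed_chronology G B K F \<and> chain_set G B K F = Q \<and>
    (\<forall>i\<in>{1..m}. \<forall>j<length (v i). A i j = act B K F (v i ! j))"
proof -
  \<comment> \<open>One sequence of start times per path; \<open>S\<close> then chooses them for all
    paths at once.\<close>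
  have "\<forall>i\<in>{1..m}. \<exists>s. s 0 = 0 \<and> s (length (v i)) = Suc K \<and>
      (\<forall>j<length (v i). s j < s (Suc j) \<and> A i j = {s j..<s (Suc j)})"
  proof
    fix i assume "i \<in> {1..m}"
    then have "block_partition K (length (v i)) (A i)" using assms(4) unfolding pip_witness_def by blast
    then show "\<exists>s. s 0 = 0 \<and> s (length (v i)) = Suc K \<and>
      (\<forall>j<length (v i). s j < s (Suc j) \<and> A i j = {s j..<s (Suc j)})"
      by (elim block_partitionE) blast
  qed
  then obtain S where S: "\<And>i. i \<in> {1..m} \<Longrightarrow> S i 0 = 0"
      "\<And>i. i \<in> {1..m} \<Longrightarrow> S i (length (v i)) = Suc K"
      "\<And>i j. i \<in> {1..m} \<Longrightarrow> j < length (v i) \<Longrightarrow> S i j < S i (Suc j)"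
      "\<And>i j. i \<in> {1..m} \<Longrightarrow> j < length (v i) \<Longrightarrow> A i j = {S i j..<S i (Suc j)}"
    by (subst (asm) bchoice_iff) blast
  note cover = labelled_cover[OF assms(1-3)]
  have cross: "S i' j' < S i (Suc j)"
    if "i \<in> {1..m}" "i' \<in> {1..m}" "i \<noteq> i'" "j < length (v i)" "j' < length (v i')"
      "v i ! j \<rightarrow>\<^bsub>G\<^esub> v i' ! j'" for i i' j j'
  proof -
    \<comment> \<open>A common time is at least the start of the second block and below the end of
      the first.\<close>
    have "A i j \<inter> A i' j' \<noteq> {}" using assms(4) that unfolding pip_witness_def by blast
    then show ?thesis using S(4) that by auto
  qed
  interpret graph G by (rule assms(1))
  interpret pip_start_times G m v K S
    by unfold_locales (fact cover(2) cover(3) cover(4) cover(5) S(1) S(2) S(3) cross)+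
  have "chain_set G B K F = (\<lambda>c. G \<restriction> set c) ` {c. is_chain c}" by (auto simp: chain_set_def)
  also have "\<dots> = Q" unfolding chains_eq cover(1) by (simp add: image_image)
  finally show ?thesis
    using zero_forcing F_relaxed_chronology act_v S(4) B_def by (intro exI[of _ B] exI[of _ F]) simp
qed

theorem theorem3p8:
  fixes G :: "('a, 'b) pre_digraph"
  assumes "graph G"
  shows
    "(\<forall>Q. parallel_increasing_path_cover G Q \<longleftrightarrow>
        (\<exists>B K F. zero_forcing_set G B \<and> relaxed_chronology G B K F \<and> Q = chain_set G B K F)) \<and>
     (\<forall>Q m v K A.
        path_cover G Q \<and> path_labelling Q m v \<and> pip_witness G m v K A \<longrightarrow>
        (\<exists>B F. B = {v i ! 0 | i. i \<in> {1..m}} \<and>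
           zero_forcing_set G B \<and> relaxed_chronology G B K F \<and> chain_set G B K F = Q \<and>
           (\<forall>i\<in>{1..m}. \<forall>j<length (v i). A i j = act B K F (v i ! j)))) \<and>
     (\<forall>B K F m v.
        zero_forcing_set G B \<and> relaxed_chronology G B K F \<and>
        bij_betw v {1..m} {c. forcing_chain B K F c} \<longrightarrow>
        path_cover G (chain_set G B K F) \<and> path_labelling (chain_set G B K F) m v \<and>
        pip_witness G m v K (\<lambda>i j. act B K F (v i ! j)))"
proof -
  have chron: "chronology G B K F" if "relaxed_chronology G B K F" for B K F
    using assms that by (simp add: chronology_def chronology_axioms_def)
  show ?thesis
  proof (intro conjI allI iffI impI; (elim conjE)?)
    fix Q assume "parallel_increasing_path_cover G Q"
    then obtain m v K A where "path_cover G Q" "path_labelling Q m v" "pip_witness G m v K A"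
      unfolding parallel_increasing_path_cover_def by blast
    from witness_chronology[OF assms this]
    obtain B F where "zero_forcing_set G B" "relaxed_chronology G B K F" "Q = chain_set G B K F"
      by blast
    then show "\<exists>B K F. zero_forcing_set G B \<and> relaxed_chronology G B K F \<and> Q = chain_set G B K F"
      by blast
  next
    fix Q assume "\<exists>B K F. zero_forcing_set G B \<and> relaxed_chronology G B K F \<and> Q = chain_set G B K F"
    then obtain B K F where "relaxed_chronology G B K F" "Q = chain_set G B K F" by blast
    then show "parallel_increasing_path_cover G Q" using chronology.chain_set_pip[OF chron] by simp
  next
    fix Q m v K A
    assume "path_cover G Q" "path_labelling Q m v" "pip_witness G m v K A"
    then show "\<exists>B F. B = {v i ! 0 | i. i \<in> {1..m}} \<and>
        zero_forcing_set G B \<and> relaxed_chronology G B K F \<and> chain_set G B K F = Q \<and>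
        (\<forall>i\<in>{1..m}. \<forall>j<length (v i). A i j = act B K F (v i ! j))"
      by (rule witness_chronology[OF assms])
  next
    fix B K F and m :: nat and v
    assume rc: "relaxed_chronology G B K F" and bij: "bij_betw v {1..m} {c. forcing_chain B K F c}"
    interpret chronology G B K F using rc by (rule chron)
    show "path_cover G (chain_set G B K F)" by (rule chain_set_path_cover)
    show "path_labelling (chain_set G B K F) m v" by (rule chain_labelling[OF bij])
    show "pip_witness G m v K (\<lambda>i j. act B K F (v i ! j))" by (rule chain_witness[OF bij])
  qed
qed

end
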